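(* Let $P=(V,\preceq)$ be a Borel poset of finite height $h$ whose comparability graph is locally countable (every element of $V$ is comparable with only countably many elements). Then $V$ can be partitioned into $h$ antichains of $P$, each of which is a Borel subset of $V$.
   Context: A Borel poset is a poset $(V,\preceq)$ where $V$ is a standard Borel space and the relation $\preceq$ is a Borel subset of $V\times V$. The height of a poset is the largest size of a chain in it. The comparability graph has vertex set $V$, with distinct comparable elements adjacent. *)

theory Defs
  imports "HOL-Analysis.Analysis"
begin

definition Polish_topology :: "'a topology \<Rightarrow> bool" where
  "Polish_topology X \<longleftrightarrow> completely_metrizable_space X \<and> separable_space X"

text \<open>Only the carrier and the sigma-algebra of a \<^typ>\<open>'a measure\<close> matter here;
  the measure itself plays no role.\<close>

definition standard_Borel_space :: "'a measure \<Rightarrow> bool" where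
  "standard_Borel_space M \<longleftrightarrow>
     (\<exists>X. Polish_topology X \<and> topspace X = space M \<and>
          sets M = sigma_sets (topspace X) {U. openin X U})"

definition Borel_poset :: "'a measure \<Rightarrow> 'a rel \<Rightarrow> bool" where
  "Borel_poset M r \<longleftrightarrow>
     standard_Borel_space M \<and> partial_order_on (space M) r \<and> r \<in> sets (M \<Otimes>\<^sub>M M)"

text \<open>The members of \<^term>\<open>Chains r\<close> lie in the ground set of the order,
  because they consist of points \<open>a\<close> with \<open>(a, a) \<in> r\<close>.\<close>

definition has_finite_height :: "'a rel \<Rightarrow> nat \<Rightarrow> bool" where
  "has_finite_height r h \<longleftrightarrow>
     (\<forall>C\<in>Chains r. finite C \<and> card C \<le> h) \<and> (\<exists>C\<in>Chains r. finite C \<and> card C = h)"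

definition comparability_graph :: "'a rel \<Rightarrow> 'a rel" where
  "comparability_graph r = {(x, y). x \<noteq> y \<and> ((x, y) \<in> r \<or> (y, x) \<in> r)}"

definition locally_countable_graph :: "'a set \<Rightarrow> 'a rel \<Rightarrow> bool" where
  "locally_countable_graph V E \<longleftrightarrow> (\<forall>x\<in>V. countable {y \<in> V. (x, y) \<in> E})"

definition antichain_in :: "'a set \<Rightarrow> 'a rel \<Rightarrow> 'a set \<Rightarrow> bool" where
  "antichain_in V r A \<longleftrightarrow> A \<subseteq> V \<and> (\<forall>x\<in>A. \<forall>y\<in>A. (x, y) \<in> r \<longrightarrow> x = y)"

end

theory Submission
  imports Defs
begin

text \<open>By induction on \<open>k\<close>, every Borel set \<open>D\<close> without chains of \<open>k + 1\<close> elements is a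
  disjoint union of \<open>k\<close> Borel antichains. For \<open>k > 0\<close>, the set of tops of \<open>k\<close>-element chains in
  \<open>D\<close> and the set of non-maximal elements of \<open>D\<close> are analytic and disjoint, so by Lusin's
  theorem some Borel set \<open>S\<close> contains the former and misses the latter. Then \<open>D \<inter> S\<close> consists
  of maximal elements of \<open>D\<close>, hence is an antichain, and \<open>D - S\<close> has no chain of \<open>k\<close> elements.
  For \<open>k = h\<close>, a chain of \<open>h\<close> elements meets each of the \<open>h\<close> antichains, so none is empty.\<close>

section \<open>The topology of Baire space\<close>

text \<open>A basic open set of the product topology restricts finitely many coordinates, all below
  some \<open>n\<close>. So sets given by a finite prefix form a base, and openness becomes a
  statement about prefixes.\<close>

lemma open_Baire_iff:
  fixes S :: "(nat \<Rightarrow> nat) set"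
  shows "open S \<longleftrightarrow> (\<forall>\<sigma>\<in>S. \<exists>n. \<forall>\<tau>. (\<forall>i<n. \<tau> i = \<sigma> i) \<longrightarrow> \<tau> \<in> S)"
proof
  assume S: "open S"
  show "\<forall>\<sigma>\<in>S. \<exists>n. \<forall>\<tau>. (\<forall>i<n. \<tau> i = \<sigma> i) \<longrightarrow> \<tau> \<in> S"
  proof
    fix \<sigma> assume "\<sigma> \<in> S"
    with S obtain X where X: "\<sigma> \<in> PiE UNIV X" "finite {i. X i \<noteq> UNIV}" "PiE UNIV X \<subseteq> S"
      using product_topology_open_contains_basis[of "\<lambda>_. euclidean" UNIV S \<sigma>]
      by (auto simp: open_fun_def)
    obtain n where n: "{i. X i \<noteq> UNIV} \<subseteq> {..<n}"
      using X(2) finite_nat_iff_bounded by blast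
    have "\<tau> \<in> S" if "\<forall>i<n. \<tau> i = \<sigma> i" for \<tau>
    proof -
      have "\<tau> i \<in> X i" for i
        using that n X(1) by (cases "X i = UNIV") (auto simp: PiE_iff subset_iff)
      then show ?thesis using X(3) by auto
    qed
    then show "\<exists>n. \<forall>\<tau>. (\<forall>i<n. \<tau> i = \<sigma> i) \<longrightarrow> \<tau> \<in> S" by blast
  qed
next
  assume S: "\<forall>\<sigma>\<in>S. \<exists>n. \<forall>\<tau>. (\<forall>i<n. \<tau> i = \<sigma> i) \<longrightarrow> \<tau> \<in> S"
  have op: "open {\<tau>. \<forall>i<n. \<tau> i = \<sigma> i}" for n and \<sigma> :: "nat \<Rightarrow> nat"
  proof -
    have "open {\<tau> :: nat \<Rightarrow> nat. \<forall>i\<in>{..<n}. \<tau> i \<in> {\<sigma> i}}"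
      by (rule product_topology_basis'[where x="\<lambda>i. i"]) (auto intro: open_discrete)
    moreover have "{\<tau> :: nat \<Rightarrow> nat. \<forall>i\<in>{..<n}. \<tau> i \<in> {\<sigma> i}} = {\<tau>. \<forall>i<n. \<tau> i = \<sigma> i}" by auto
    ultimately show ?thesis by simp
  qed
  show "open S"
  proof (subst open_subopen, intro ballI)
    fix \<sigma> assume "\<sigma> \<in> S"
    with S obtain n where "\<forall>\<tau>. (\<forall>i<n. \<tau> i = \<sigma> i) \<longrightarrow> \<tau> \<in> S" by blast
    then show "\<exists>T. open T \<and> \<sigma> \<in> T \<and> T \<subseteq> S"
      by (intro exI[of _ "{\<tau>. \<forall>i<n. \<tau> i = \<sigma> i}"]) (auto simp: op)
  qed
qed

text \<open>Membership is settled by the first entry and a finite prefix of the tail. This glues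
  countably many open sets together, with the first entry as index.\<close>

lemma open_Baire_shift:
  fixes W :: "nat \<Rightarrow> (nat \<Rightarrow> nat) set"
  assumes "\<And>i. open (W i)"
  shows "open {\<sigma>. (\<lambda>k. \<sigma> (Suc k)) \<in> W (\<sigma> 0)}"
  unfolding open_Baire_iff
proof
  fix \<sigma> assume "\<sigma> \<in> {\<sigma>. (\<lambda>k. \<sigma> (Suc k)) \<in> W (\<sigma> 0)}"
  then obtain n where n: "\<And>\<tau>. (\<forall>i<n. \<tau> i = \<sigma> (Suc i)) \<Longrightarrow> \<tau> \<in> W (\<sigma> 0)"
    using assms[of "\<sigma> 0"] unfolding open_Baire_iff mem_Collect_eq by metis
  show "\<exists>n. \<forall>\<tau>. (\<forall>i<n. \<tau> i = \<sigma> i) \<longrightarrow> \<tau> \<in> {\<sigma>. (\<lambda>k. \<sigma> (Suc k)) \<in> W (\<sigma> 0)}"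
    by (rule exI[of _ "Suc n"]) (use n in auto)
qed

section \<open>Analytic sets and their closure properties\<close>

text \<open>Closed sets of codes, rather than all of Baire space, cover the empty set as well and
  allow codes to be cut down by closed conditions.\<close>

definition analytic_in :: "'a topology \<Rightarrow> 'a set \<Rightarrow> bool" where
  "analytic_in X A \<longleftrightarrow>
     (\<exists>(C :: (nat \<Rightarrow> nat) set) f. closed C \<and> continuous_map (top_of_set C) X f \<and> f ` C = A)"

lemma analytic_in_subset: "analytic_in X A \<Longrightarrow> A \<subseteq> topspace X"
  unfolding analytic_in_def continuous_map_def by auto

lemma analytic_in_image:
  assumes "analytic_in X A" "continuous_map X Y g"
  shows "analytic_in Y (g ` A)"
proof -
  obtain C :: "(nat \<Rightarrow> nat) set" and f
    where "closed C" "continuous_map (top_of_set C) X f" "f ` C = A"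
    using assms(1) unfolding analytic_in_def by blast
  then have "closed C \<and> continuous_map (top_of_set C) Y (g \<circ> f) \<and> (g \<circ> f) ` C = g ` A"
    using assms(2) by (metis continuous_map_compose image_comp)
  then show ?thesis unfolding analytic_in_def by blast
qed

lemma analytic_in_Int_closedin:
  assumes "analytic_in X A" "closedin X F"
  shows "analytic_in X (A \<inter> F)"
proof -
  obtain C :: "(nat \<Rightarrow> nat) set" and f
    where C: "closed C" and f: "continuous_map (top_of_set C) X f" and A: "f ` C = A"
    using assms(1) unfolding analytic_in_def by blast
  define C' where "C' = {\<sigma> \<in> C. f \<sigma> \<in> F}"
  have "closedin (top_of_set C) C'"
    using closedin_continuous_map_preimage[OF f assms(2)] by (simp add: C'_def)
  then have "closed C'" using C closedin_closed_eq by blast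
  moreover have "continuous_map (top_of_set C') X f"
    by (rule continuous_map_from_subtopology_mono[OF f]) (auto simp: C'_def)
  moreover have "f ` C' = A \<inter> F" using A by (auto simp: C'_def)
  ultimately show ?thesis unfolding analytic_in_def by blast
qed

text \<open>The first entry of a code names an index \<open>n\<close>, and the tail is a code for a
  point of \<open>A n\<close>.\<close>

lemma analytic_in_UN:
  assumes "\<And>n :: nat. analytic_in X (A n)"
  shows "analytic_in X (\<Union>n. A n)"
proof -
  have "\<exists>C f. \<forall>n. closed (C n :: (nat \<Rightarrow> nat) set) \<and> continuous_map (top_of_set (C n)) X (f n)
      \<and> f n ` C n = A n"
    using assms unfolding analytic_in_def by metis
  then obtain C f where C: "\<And>n. closed (C n :: (nat \<Rightarrow> nat) set)"
    and f: "\<And>n. continuous_map (top_of_set (C n)) X (f n)" and A: "\<And>n. f n ` C n = A n"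
    by blast
  define D where "D = {\<sigma>. (\<lambda>k. \<sigma> (Suc k)) \<in> C (\<sigma> 0)}"
  define g where "g \<sigma> = f (\<sigma> 0) (\<lambda>k. \<sigma> (Suc k))" for \<sigma>
  have "closed D"
  proof -
    have "- D = {\<sigma>. (\<lambda>k. \<sigma> (Suc k)) \<in> - C (\<sigma> 0)}" by (auto simp: D_def)
    then show ?thesis
      using open_Baire_shift[of "\<lambda>i. - C i"] C by (metis closed_def)
  qed
  moreover have "continuous_map (top_of_set D) X g"
    unfolding continuous_map_def
  proof (intro conjI allI impI)
    show "g \<in> topspace (top_of_set D) \<rightarrow> topspace X"
      using f by (auto simp: g_def D_def continuous_map_def Pi_iff)
    fix U assume U: "openin X U"
    \<comment> \<open>Each preimage is only relatively open in \<open>C n\<close>; choosing open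
      sets \<open>W n\<close> of the whole space makes the shift lemma applicable.\<close>
    have "\<exists>W. open W \<and> {\<sigma> \<in> C n. f n \<sigma> \<in> U} = C n \<inter> W" for n
      using openin_continuous_map_preimage[OF f U, of n] by (simp add: openin_open)
    then obtain W where W: "\<And>n. open (W n)" "\<And>n. {\<sigma> \<in> C n. f n \<sigma> \<in> U} = C n \<inter> W n"
      by metis
    have "{\<sigma> \<in> D. g \<sigma> \<in> U} = D \<inter> {\<sigma>. (\<lambda>k. \<sigma> (Suc k)) \<in> W (\<sigma> 0)}"
      using W(2) by (auto simp: D_def g_def set_eq_iff)
    then show "openin (top_of_set D) {x \<in> topspace (top_of_set D). g x \<in> U}"
      using open_Baire_shift[of W] W(1) by (auto simp: openin_open)
  qed
  moreover have "g ` D = (\<Union>n. A n)"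
  proof
    show "g ` D \<subseteq> (\<Union>n. A n)" using A by (auto simp: g_def D_def)
    show "(\<Union>n. A n) \<subseteq> g ` D"
    proof
      fix x assume "x \<in> (\<Union>n. A n)"
      then obtain n \<sigma> where "\<sigma> \<in> C n" "x = f n \<sigma>" using A by blast
      then show "x \<in> g ` D"
        by (intro image_eqI[of _ _ "case_nat n \<sigma>"]) (auto simp: g_def D_def)
    qed
  qed
  ultimately show ?thesis unfolding analytic_in_def by blast
qed

text \<open>A countable fibre product, which yields countable intersections and preimages at once. A
  code for \<open>x\<close> is bundled with codes for all points \<open>g n x\<close>. The set
  \<open>E\<close> supplies codes for the points of \<open>X\<close>, which need not be analytic
  itself.\<close>

lemma analytic_in_Int_INT_vimage:
  fixes A :: "nat \<Rightarrow> 'b set"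
  assumes E: "analytic_in X E" and A: "\<And>n. analytic_in Y (A n)"
    and g: "\<And>n. continuous_map X Y (g n)" and Y: "Hausdorff_space Y"
  shows "analytic_in X {x \<in> E. \<forall>n. g n x \<in> A n}"
proof -
  obtain C0 :: "(nat \<Rightarrow> nat) set" and f0
    where C0: "closed C0" and f0: "continuous_map (top_of_set C0) X f0" and E0: "f0 ` C0 = E"
    using E unfolding analytic_in_def by blast
  have "\<exists>C f. \<forall>n. closed (C n :: (nat \<Rightarrow> nat) set) \<and> continuous_map (top_of_set (C n)) Y (f n)
      \<and> f n ` C n = A n"
    using A unfolding analytic_in_def by metis
  then obtain C f where C: "\<And>n. closed (C n :: (nat \<Rightarrow> nat) set)"
    and f: "\<And>n. continuous_map (top_of_set (C n)) Y (f n)" and A: "\<And>n. f n ` C n = A n"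
    by blast
  \<comment> \<open>One sequence \<open>\<sigma>\<close> codes countably many: its component 0 codes a point of \<open>E\<close>,
    its component \<open>n + 1\<close> a point of \<open>A n\<close>.\<close>
  define c where "c n \<sigma> = (\<lambda>k. \<sigma> (prod_encode (n, k)))" for n and \<sigma> :: "nat \<Rightarrow> nat"
  have c: "continuous_on UNIV (c n)" for n
    unfolding c_def by (intro continuous_on_coordinatewise_then_product) simp
  define D where "D = {\<sigma>. c 0 \<sigma> \<in> C0 \<and> (\<forall>n. c (Suc n) \<sigma> \<in> C n)}"
  have "D = c 0 -` C0 \<inter> (\<Inter>n. c (Suc n) -` C n)" by (auto simp: D_def)
  then have D: "closed D"
    using C0 C c by (simp add: closed_Int closed_INT closed_vimage)
  have cmap: "continuous_map (top_of_set D) (top_of_set S) (c n)" if "\<And>\<sigma>. \<sigma> \<in> D \<Longrightarrow> c n \<sigma> \<in> S" for n S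
    using that continuous_on_subset[OF c] by (auto simp: continuous_map_in_subtopology)
  have h0: "continuous_map (top_of_set D) X (f0 \<circ> c 0)"
    by (rule continuous_map_compose[OF _ f0], rule cmap) (auto simp: D_def)
  have h: "continuous_map (top_of_set D) Y (f n \<circ> c (Suc n))" for n
    by (rule continuous_map_compose[OF _ f], rule cmap) (auto simp: D_def)
  have gh: "continuous_map (top_of_set D) Y (g n \<circ> (f0 \<circ> c 0))" for n
    by (rule continuous_map_compose[OF h0 g])
  \<comment> \<open>The components must code matching points. These are equalities of continuous
    maps into a Hausdorff space, hence closed conditions.\<close>
  define D' where "D' = (\<Inter>n. {\<sigma> \<in> D. (g n \<circ> (f0 \<circ> c 0)) \<sigma> = (f n \<circ> c (Suc n)) \<sigma>})"
  have "closedin (top_of_set D) {\<sigma> \<in> D. (g n \<circ> (f0 \<circ> c 0)) \<sigma> = (f n \<circ> c (Suc n)) \<sigma>}" for n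
    using closedin_continuous_maps_eq[OF Y gh h, of n n] by simp
  then have "closed {\<sigma> \<in> D. (g n \<circ> (f0 \<circ> c 0)) \<sigma> = (f n \<circ> c (Suc n)) \<sigma>}" for n
    using D closedin_closed_eq by blast
  then have "closed D'" unfolding D'_def by (intro closed_INT ballI) 
  moreover have "continuous_map (top_of_set D') X (f0 \<circ> c 0)"
    by (rule continuous_map_from_subtopology_mono[OF h0]) (auto simp: D'_def)
  moreover have "(f0 \<circ> c 0) ` D' = {x \<in> E. \<forall>n. g n x \<in> A n}"
  proof
    show "(f0 \<circ> c 0) ` D' \<subseteq> {x \<in> E. \<forall>n. g n x \<in> A n}"
      using A E0 by (fastforce simp: D'_def D_def)
    show "{x \<in> E. \<forall>n. g n x \<in> A n} \<subseteq> (f0 \<circ> c 0) ` D'"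
    proof
      fix x assume x: "x \<in> {x \<in> E. \<forall>n. g n x \<in> A n}"
      then obtain s where s: "s \<in> C0" "x = f0 s" using E0 by blast
      have "\<forall>n. \<exists>t. t \<in> C n \<and> g n x = f n t" using x A by blast
      then obtain t where t: "\<And>n. t n \<in> C n" "\<And>n. g n x = f n (t n)" by metis
      \<comment> \<open>Interleaves \<open>s\<close> and all \<open>t m\<close> along the pairing
        function, inverting the component maps \<open>c\<close>.\<close>
      define \<sigma> where "\<sigma> p = (case prod_decode p of (n, k) \<Rightarrow> (case n of 0 \<Rightarrow> s | Suc m \<Rightarrow> t m) k)" for p
      have "c 0 \<sigma> = s" "\<And>n. c (Suc n) \<sigma> = t n" by (auto simp: c_def \<sigma>_def)
      then have "\<sigma> \<in> D'" "x = (f0 \<circ> c 0) \<sigma>" using s t by (auto simp: D'_def D_def)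
      then show "x \<in> (f0 \<circ> c 0) ` D'" by blast
    qed
  qed
  ultimately show ?thesis unfolding analytic_in_def by blast
qed

lemma analytic_in_Int_vimage:
  assumes "analytic_in X E" "analytic_in Y A" "continuous_map X Y g" "Hausdorff_space Y"
  shows "analytic_in X {x \<in> E. g x \<in> A}"
  using analytic_in_Int_INT_vimage[of X E Y "\<lambda>_. A" "\<lambda>_. g"] assms by simp

lemma analytic_in_INT:
  assumes "\<And>n :: nat. analytic_in X (A n)" "Hausdorff_space X"
  shows "analytic_in X (\<Inter>n. A n)"
proof -
  have "{x \<in> A 0. \<forall>n. id x \<in> A n} = (\<Inter>n. A n)" by auto
  then show ?thesis
    using analytic_in_Int_INT_vimage[of X "A 0" X A "\<lambda>_. id"] assms by simp
qed

section \<open>Polish spaces and their Borel sets are analytic\<close>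

text \<open>Completeness makes every rapidly converging sequence from a countable dense set
  converge, and density makes every point such a limit. The geometric rate makes the limit depend
  continuously on the code.\<close>

lemma analytic_in_topspace:
  assumes "Polish_topology X"
  shows "analytic_in X (topspace X)"
proof (cases "topspace X = {}")
  case True
  have "continuous_map (top_of_set {}) X (\<lambda>_ :: nat \<Rightarrow> nat. undefined)" 
    by (simp add: continuous_map_on_empty)
  then show ?thesis unfolding analytic_in_def True by (metis closed_empty image_empty)
next
  case False
  obtain M d where "Metric_space M d" and mc: "Metric_space.mcomplete M d"
    and X: "X = Metric_space.mtopology M d"
    using assms unfolding Polish_topology_def completely_metrizable_space_def by blast
  interpret Metric_space M d by fact
  obtain K where K: "countable K" "K \<subseteq> M" "mtopology closure_of K = M"
    using assms X unfolding Polish_topology_def separable_space_def by auto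
  have "K \<noteq> {}" using K False X by auto
  define q where "q = from_nat_into K"
  have q: "range q = K" using \<open>K \<noteq> {}\<close> K(1) by (simp add: q_def range_from_nat_into)
  have qM: "q i \<in> M" for i using q K(2) by auto
  have dense: "\<exists>i. d (q i) x < \<epsilon>" if "x \<in> M" "\<epsilon> > 0" for x \<epsilon>
    using that K(3) q unfolding metric_closure_of by (force simp: commute)
  \<comment> \<open>A sequence codes the limit of the corresponding rapidly converging sequence in \<open>K\<close>.\<close>
  define C where "C = {\<sigma>. \<forall>n. d (q (\<sigma> n)) (q (\<sigma> (Suc n))) \<le> (1/2) ^ n}"
  have "closed C"
    unfolding closed_def open_Baire_iff
  proof
    fix \<sigma> assume "\<sigma> \<in> - C"
    then obtain n where n: "\<not> d (q (\<sigma> n)) (q (\<sigma> (Suc n))) \<le> (1/2) ^ n" by (auto simp: C_def)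
    \<comment> \<open>The violated condition involves the entries \<open>n\<close> and
      \<open>Suc n\<close>, so a prefix of length \<open>n + 2\<close> preserves it.\<close>
    have "\<tau> \<in> - C" if "\<forall>i<n + 2. \<tau> i = \<sigma> i" for \<tau>
    proof -
      have "\<tau> n = \<sigma> n" "\<tau> (Suc n) = \<sigma> (Suc n)" using that by auto
      then have "\<not> d (q (\<tau> n)) (q (\<tau> (Suc n))) \<le> (1/2) ^ n" using n by simp
      then show ?thesis unfolding C_def by blast
    qed
    then show "\<exists>n. \<forall>\<tau>. (\<forall>i<n. \<tau> i = \<sigma> i) \<longrightarrow> \<tau> \<in> - C" by blast
  qed
  \<comment> \<open>The bound is the exact geometric sum, which lets the induction close;
    \<open>tail'\<close> then drops the subtracted term.\<close>
  have tail: "d (q (\<sigma> n)) (q (\<sigma> (n + k))) \<le> 2 * (1/2) ^ n - 2 * (1/2) ^ (n + k)"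
    if "\<sigma> \<in> C" for \<sigma> n k
  proof (induction k)
    case (Suc k)
    have "d (q (\<sigma> n)) (q (\<sigma> (n + Suc k)))
        \<le> d (q (\<sigma> n)) (q (\<sigma> (n + k))) + d (q (\<sigma> (n + k))) (q (\<sigma> (Suc (n + k))))"
      using triangle[OF qM qM qM] by simp
    also have "d (q (\<sigma> (n + k))) (q (\<sigma> (Suc (n + k)))) \<le> (1/2) ^ (n + k)"
      using that by (auto simp: C_def)
    finally show ?case using Suc by simp
  qed (simp add: qM)
  have tail': "d (q (\<sigma> n)) (q (\<sigma> m)) \<le> 2 * (1/2) ^ n" if "\<sigma> \<in> C" "n \<le> m" for \<sigma> n m
  proof -
    have "d (q (\<sigma> n)) (q (\<sigma> m)) \<le> 2 * (1/2) ^ n - 2 * (1/2) ^ m"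
      using tail[OF that(1), of n "m - n"] that(2) by simp
    also have "\<dots> \<le> 2 * (1/2) ^ n" by simp
    finally show ?thesis .
  qed
  have small: "\<exists>n. c * (1/2) ^ n < \<epsilon>" if \<epsilon>c: "\<epsilon> > 0" "c > 0" for \<epsilon> c :: real
  proof -
    obtain n where "(1/2) ^ n < \<epsilon> / c"
      using real_arch_pow_inv[OF divide_pos_pos[OF \<epsilon>c], of "1/2"] by auto
    then show ?thesis using \<epsilon>c by (auto simp: field_simps)
  qed
  have "\<exists>l. limitin mtopology (\<lambda>n. q (\<sigma> n)) l sequentially" if "\<sigma> \<in> C" for \<sigma>
  proof -
    have "MCauchy (\<lambda>n. q (\<sigma> n))"
      unfolding MCauchy_def
    proof (intro conjI allI impI)
      fix \<epsilon> :: real assume "\<epsilon> > 0"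
      then obtain N where N: "2 * (1/2) ^ N < \<epsilon>/2" using small[of "\<epsilon>/2" 2] by auto
      have "d (q (\<sigma> n)) (q (\<sigma> n')) < \<epsilon>" if "N \<le> n" "N \<le> n'" for n n'
        using triangle''[of "q (\<sigma> n)" "q (\<sigma> N)" "q (\<sigma> n')"] qM
          tail'[OF \<open>\<sigma> \<in> C\<close> that(1)] tail'[OF \<open>\<sigma> \<in> C\<close> that(2)] N by fastforce
      then show "\<exists>N. \<forall>n n'. N \<le> n \<longrightarrow> N \<le> n' \<longrightarrow> d (q (\<sigma> n)) (q (\<sigma> n')) < \<epsilon>" by blast
    qed (use qM in auto)
    then show ?thesis using mc unfolding mcomplete_def by blast
  qed
  then obtain f where f: "\<And>\<sigma>. \<sigma> \<in> C \<Longrightarrow> limitin mtopology (\<lambda>n. q (\<sigma> n)) (f \<sigma>) sequentially"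
    by metis
  have fM: "f \<sigma> \<in> M" if "\<sigma> \<in> C" for \<sigma> using f[OF that] limitin_mspace by blast
  \<comment> \<open>The tail bound passes to the limit: compare with a term so late that it is
    within \<open>e\<close> of \<open>f \<sigma>\<close>.\<close>
  have est: "d (q (\<sigma> n)) (f \<sigma>) \<le> 2 * (1/2) ^ n" if \<sigma>: "\<sigma> \<in> C" for \<sigma> n
  proof (rule field_le_epsilon)
    fix e :: real assume "e > 0"
    then obtain N where N: "\<forall>m\<ge>N. d (q (\<sigma> m)) (f \<sigma>) < e"
      using f[OF \<sigma>] unfolding limit_metric_sequentially by blast
    let ?m = "max n N"
    have "d (q (\<sigma> n)) (f \<sigma>) \<le> d (q (\<sigma> n)) (q (\<sigma> ?m)) + d (q (\<sigma> ?m)) (f \<sigma>)"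
      using triangle qM fM[OF \<sigma>] by blast
    also have "\<dots> \<le> 2 * (1/2) ^ n + e"
      using N tail'[OF \<sigma>, of n ?m] by (intro add_mono) (auto simp: less_imp_le)
    finally show "d (q (\<sigma> n)) (f \<sigma>) \<le> 2 * (1/2) ^ n + e" .
  qed
  have "continuous_map (top_of_set C) X f"
    unfolding X continuous_map_to_metric
  proof (intro ballI allI impI)
    fix \<sigma> and \<epsilon> :: real assume "\<sigma> \<in> topspace (top_of_set C)" and "\<epsilon> > 0"
    then have \<sigma>: "\<sigma> \<in> C" by simp
    \<comment> \<open>Codes agreeing up to and including entry \<open>n\<close> share the point
      \<open>q (\<sigma> n)\<close>, and each limit is within \<open>2 * (1/2) ^ n\<close> of it,
      hence the factor 4.\<close>
    obtain n where n: "4 * (1/2) ^ n < \<epsilon>" using small[of \<epsilon> 4] \<open>\<epsilon> > 0\<close> by auto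
    define U where "U = {\<tau> :: nat \<Rightarrow> nat. \<forall>i<Suc n. \<tau> i = \<sigma> i}"
    have "open U" unfolding open_Baire_iff U_def by (auto intro!: exI[of _ "Suc n"])
    moreover have "f \<tau> \<in> mball (f \<sigma>) \<epsilon>" if "\<tau> \<in> C \<inter> U" for \<tau>
    proof -
      have \<tau>: "\<tau> \<in> C" "\<tau> n = \<sigma> n" using that by (auto simp: U_def)
      have "d (f \<sigma>) (f \<tau>) \<le> d (q (\<sigma> n)) (f \<sigma>) + d (q (\<tau> n)) (f \<tau>)"
        using triangle[OF fM[OF \<sigma>] qM fM[OF \<tau>(1)], of "\<sigma> n"] \<tau>(2) by (simp add: commute)
      then show ?thesis
        using est[OF \<sigma>, of n] est[OF \<tau>(1), of n] n fM \<sigma> \<tau>(1) by simp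
    qed
    ultimately show "\<exists>U. openin (top_of_set C) U \<and> \<sigma> \<in> U \<and> (\<forall>y\<in>U. f y \<in> mball (f \<sigma>) \<epsilon>)"
      using \<sigma> by (intro exI[of _ "C \<inter> U"]) (auto simp: U_def)
  qed
  moreover have "f ` C = M"
  proof
    show "f ` C \<subseteq> M" using fM by auto
    show "M \<subseteq> f ` C"
    proof
      fix x assume x: "x \<in> M"
      \<comment> \<open>The exponent \<open>Suc n\<close> makes the errors of two consecutive
        approximants add up to at most \<open>(1/2) ^ n\<close>, as \<open>C\<close>
        demands.\<close>
      have "\<forall>n. \<exists>i. d (q i) x < (1/2) ^ Suc n" using dense[OF x] by (auto simp del: power_Suc)
      then obtain \<sigma> where \<sigma>: "\<And>n. d (q (\<sigma> n)) x < (1/2) ^ Suc n" by metis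
      have "d (q (\<sigma> n)) (q (\<sigma> (Suc n))) \<le> (1/2) ^ n" for n
      proof -
        have "d (q (\<sigma> n)) (q (\<sigma> (Suc n))) \<le> d (q (\<sigma> n)) x + d (q (\<sigma> (Suc n))) x"
          using triangle[OF qM x qM] by (simp add: commute)
        moreover have "(1/2) ^ Suc (Suc n) \<le> ((1/2) ^ Suc n :: real)" by simp
        moreover have "(1/2) ^ Suc n + (1/2) ^ Suc n = ((1/2) ^ n :: real)" by simp
        ultimately show ?thesis using \<sigma>[of n] \<sigma>[of "Suc n"] by linarith
      qed
      then have "\<sigma> \<in> C" by (simp add: C_def)
      moreover have "limitin mtopology (\<lambda>n. q (\<sigma> n)) x sequentially"
        unfolding limit_metric_sequentially
      proof (intro conjI allI impI)
        fix \<epsilon> :: real assume "\<epsilon> > 0"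
        then obtain N where N: "1 * (1/2) ^ N < \<epsilon>" using small[of \<epsilon> 1] by auto
        have "d (q (\<sigma> n)) x < \<epsilon>" if "n \<ge> N" for n
        proof -
          have "(1/2) ^ Suc n \<le> ((1/2) ^ N :: real)" using that by (intro power_decreasing) auto
          then show ?thesis using \<sigma>[of n] N by linarith
        qed
        then show "\<exists>N. \<forall>n\<ge>N. q (\<sigma> n) \<in> M \<and> d (q (\<sigma> n)) x < \<epsilon>" using qM by blast
      qed (use x in auto)
      ultimately show "x \<in> f ` C"
        using limitin_metric_unique[OF f] trivial_limit_sequentially by blast
    qed
  qed
  ultimately show ?thesis
    unfolding analytic_in_def X using \<open>closed C\<close> X by auto
qed

lemma Polish_topology_openin:
  assumes "Polish_topology X" "openin X U"
  shows "Polish_topology (subtopology X U)"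
  using assms completely_metrizable_space_openin separable_space_open_subset
  unfolding Polish_topology_def by blast

lemma Polish_topology_prod:
  assumes "Polish_topology X" "Polish_topology Y"
  shows "Polish_topology (prod_topology X Y)"
proof -
  obtain C where C: "countable C" "C \<subseteq> topspace X" "X closure_of C = topspace X"
    using assms(1) unfolding Polish_topology_def separable_space_def by blast
  obtain D where D: "countable D" "D \<subseteq> topspace Y" "Y closure_of D = topspace Y"
    using assms(2) unfolding Polish_topology_def separable_space_def by blast
  have "separable_space (prod_topology X Y)"
    unfolding separable_space_def using C D
    by (intro exI[of _ "C \<times> D"]) (auto simp: closure_of_Times)
  then show ?thesis
    using assms unfolding Polish_topology_def by (simp add: completely_metrizable_space_prod_topology)
qed

lemma Polish_imp_Hausdorff: "Polish_topology X \<Longrightarrow> Hausdorff_space X"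
  unfolding Polish_topology_def
  using completely_metrizable_imp_metrizable_space metrizable_imp_Hausdorff_space by blast

text \<open>An open subspace of a Polish space is Polish, so it is analytic in itself; the inclusion
  map carries this over to \<open>X\<close>.\<close>

lemma analytic_in_openin:
  assumes "Polish_topology X" "openin X U"
  shows "analytic_in X U"
proof -
  have "continuous_map (subtopology X U) X id"
    by (simp add: continuous_map_from_subtopology)
  from analytic_in_image[OF analytic_in_topspace[OF Polish_topology_openin[OF assms]] this]
  show ?thesis using openin_subset[OF assms(2)] by (simp add: Int_absorb1)
qed

lemma sigma_algebra_openin: "sigma_algebra (topspace X) (sigma_sets (topspace X) {U. openin X U})"
  using openin_subset by (intro sigma_algebra_sigma_sets) blast

text \<open>Analytic sets need not have analytic complements, so the induction carries a set and its
  complement together. Complements of countable unions are handled by countable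
  intersections.\<close>

lemma analytic_in_Borel:
  assumes X: "Polish_topology X" and A: "A \<in> sigma_sets (topspace X) {U. openin X U}"
  shows "analytic_in X A"
proof -
  have "analytic_in X A \<and> analytic_in X (topspace X - A)"
    using A
  proof induction
    case (Basic U)
    have "topspace X \<inter> (topspace X - U) = topspace X - U" by auto
    then show ?case
      using Basic analytic_in_openin[OF X]
        analytic_in_Int_closedin[OF analytic_in_topspace[OF X], of "topspace X - U"] by auto
  next
    case Empty
    then show ?case using analytic_in_openin[OF X] by simp
  next
    case (Compl A)
    then show ?case using analytic_in_subset[of X A] by (simp add: double_diff)
  next
    case (Union A)
    have "topspace X - (\<Union>n. A n) = (\<Inter>n. topspace X - A n)" by auto
    then show ?case
      using Union analytic_in_UN[of X A] analytic_in_INT[of X "\<lambda>n. topspace X - A n"]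
        Polish_imp_Hausdorff[OF X] by simp
  qed
  then show ?thesis ..
qed

section \<open>Lusin's separation theorem\<close>

definition separated_by :: "'a set set \<Rightarrow> 'a set \<Rightarrow> 'a set \<Rightarrow> bool" where
  "separated_by \<S> A B \<longleftrightarrow> (\<exists>S\<in>\<S>. A \<subseteq> S \<and> S \<inter> B = {})"

text \<open>If \<open>S i j\<close> separates \<open>A i\<close> from \<open>B j\<close>, then the
  union over \<open>i\<close> of the intersections over \<open>j\<close> of \<open>S i j\<close>
  separates the unions.\<close>

lemma separated_by_UN:
  fixes A B :: "nat \<Rightarrow> 'a set"
  assumes "sigma_algebra \<Omega> \<S>" and "\<And>i j. separated_by \<S> (A i) (B j)"
  shows "separated_by \<S> (\<Union>i. A i) (\<Union>j. B j)"
proof -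
  interpret sigma_algebra \<Omega> \<S> by fact
  obtain S where S: "\<And>i j. S i j \<in> \<S>" "\<And>i j. A i \<subseteq> S i j" "\<And>i j. S i j \<inter> B j = {}"
    using assms(2) unfolding separated_by_def by metis
  have "(\<Union>i. \<Inter>j. S i j) \<in> \<S>"
    using S(1) by (intro countable_UN countable_INT) auto
  moreover have "(\<Union>i. A i) \<subseteq> (\<Union>i. \<Inter>j. S i j)" using S(2) by blast
  moreover have "(\<Union>i. \<Inter>j. S i j) \<inter> (\<Union>j. B j) = {}" using S(3) by blast
  ultimately show ?thesis unfolding separated_by_def by blast
qed

text \<open>Otherwise there are branches \<open>\<sigma>\<close> and \<open>\<tau>\<close> whose
  cylinders have inseparable images at every level. But \<open>f \<sigma>\<close> and
  \<open>g \<tau>\<close> are distinct and have disjoint open neighbourhoods, which by continuity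
  contain the images of small cylinders, so an open set separates them.\<close>

lemma Lusin_separation:
  assumes X: "Hausdorff_space X" and "analytic_in X A" "analytic_in X B" "A \<inter> B = {}"
  shows "separated_by (sigma_sets (topspace X) {U. openin X U}) A B"
proof (rule ccontr)
  let ?S = "sigma_sets (topspace X) {U. openin X U}"
  have sa: "sigma_algebra (topspace X) ?S"
    by (rule sigma_algebra_openin)
  interpret sigma_algebra "topspace X" ?S by (rule sa)
  assume nsep: "\<not> separated_by ?S A B"
  obtain C :: "(nat \<Rightarrow> nat) set" and f
    where C: "closed C" and f: "continuous_map (top_of_set C) X f" and A: "f ` C = A"
    using assms(2) unfolding analytic_in_def by blast
  obtain D :: "(nat \<Rightarrow> nat) set" and g
    where D: "closed D" and g: "continuous_map (top_of_set D) X g" and B: "g ` D = B"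
    using assms(3) unfolding analytic_in_def by blast
  define cyl where "cyl \<sigma> n = {\<tau> :: nat \<Rightarrow> nat. \<forall>i<n. \<tau> i = \<sigma> i}" for \<sigma> n
  have open_cyl: "\<exists>n. cyl \<rho> n \<subseteq> T" if "open T" "\<rho> \<in> T" for T \<rho>
    using that unfolding open_Baire_iff cyl_def subset_iff mem_Collect_eq by (elim ballE) auto
  have cyl_Suc: "cyl \<sigma> n = (\<Union>i. cyl (\<sigma>(n := i)) (Suc n))" for \<sigma> n
    by (auto simp: cyl_def less_Suc_eq)
  \<comment> \<open>Only the first \<open>n\<close> entries of the two sequences in \<open>x\<close>
    matter for \<open>P n x\<close>; \<open>Q n\<close> says that a later pair keeps these
    entries.\<close>
  define P where "P n x \<longleftrightarrow> \<not> separated_by ?S (f ` (C \<inter> cyl (fst x) n)) (g ` (D \<inter> cyl (snd x) n))"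
    for n and x :: "(nat \<Rightarrow> nat) \<times> (nat \<Rightarrow> nat)"
  define Q where "Q n x y \<longleftrightarrow> (\<forall>i<n. fst y i = fst x i \<and> snd y i = snd x i)"
    for n and x y :: "(nat \<Rightarrow> nat) \<times> (nat \<Rightarrow> nat)"
  \<comment> \<open>If the images of all pairs of subcylinders could be separated, so could those of the cylinders;
    hence inseparability propagates along a pair of branches.\<close>
  have "\<exists>x. \<forall>n. P n (x n) \<and> Q n (x n) (x (Suc n))"
  proof (rule dependent_nat_choice)
    show "\<exists>x. P 0 x" using nsep A B by (simp add: P_def cyl_def)
  next
    fix x n assume x: "P n x"
    have "\<exists>i j. \<not> separated_by ?S (f ` (C \<inter> cyl ((fst x)(n := i)) (Suc n)))
        (g ` (D \<inter> cyl ((snd x)(n := j)) (Suc n)))"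
    proof (rule ccontr)
      assume "\<not> ?thesis"
      then have "separated_by ?S (\<Union>i. f ` (C \<inter> cyl ((fst x)(n := i)) (Suc n)))
          (\<Union>j. g ` (D \<inter> cyl ((snd x)(n := j)) (Suc n)))"
        by (intro separated_by_UN[OF sa]) blast
      moreover have "(\<Union>i. f ` (C \<inter> cyl ((fst x)(n := i)) (Suc n))) = f ` (C \<inter> cyl (fst x) n)"
        by (subst (2) cyl_Suc) blast
      moreover have "(\<Union>j. g ` (D \<inter> cyl ((snd x)(n := j)) (Suc n))) = g ` (D \<inter> cyl (snd x) n)"
        by (subst (2) cyl_Suc) blast
      ultimately show False using x by (simp add: P_def)
    qed
    then obtain i j where "P (Suc n) ((fst x)(n := i), (snd x)(n := j))" by (auto simp: P_def)
    moreover have "Q n x ((fst x)(n := i), (snd x)(n := j))" by (simp add: Q_def)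
    ultimately show "\<exists>y. P (Suc n) y \<and> Q n x y" by blast
  qed
  then obtain x where P: "\<And>n. P n (x n)" and Q: "\<And>n. Q n (x n) (x (Suc n))" by blast
  have Q': "Q n (x n) (x (n + k))" for n k
  proof (induction k)
    case (Suc k)
    then show ?case using Q[of "n + k"] by (simp add: Q_def)
  qed (simp add: Q_def)
  \<comment> \<open>Entry \<open>i\<close> is final from stage \<open>Suc i\<close> on, so the
    diagonal agrees with stage \<open>n\<close> below \<open>n\<close>.\<close>
  define \<sigma> \<tau> where "\<sigma> i = fst (x (Suc i)) i" and "\<tau> i = snd (x (Suc i)) i" for i
  have "fst (x n) i = \<sigma> i \<and> snd (x n) i = \<tau> i" if "i < n" for n i
    using Q'[of "Suc i" "n - Suc i"] that by (simp add: Q_def \<sigma>_def \<tau>_def)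
  then have "cyl (fst (x n)) n = cyl \<sigma> n" "cyl (snd (x n)) n = cyl \<tau> n" for n
    by (auto simp: cyl_def)
  then have ns: "\<not> separated_by ?S (f ` (C \<inter> cyl \<sigma> n)) (g ` (D \<inter> cyl \<tau> n))" for n
    using P[of n] by (simp add: P_def)
  have sub: "f ` C \<subseteq> topspace X" "g ` D \<subseteq> topspace X"
    using f g by (auto simp: continuous_map_def)
  \<comment> \<open>An empty image would be separated by the empty set or by the whole space. With
    closedness, nonempty cylinders at every level put the branches into \<open>C\<close> and
    \<open>D\<close>.\<close>
  have ne: "C \<inter> cyl \<sigma> n \<noteq> {}" "D \<inter> cyl \<tau> n \<noteq> {}" for n
  proof -
    have "separated_by ?S {} E" "F \<subseteq> topspace X \<Longrightarrow> separated_by ?S F {}" for E F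
      using top empty_sets unfolding separated_by_def by blast+
    moreover have "f ` (C \<inter> cyl \<sigma> n) \<subseteq> topspace X" using sub by blast
    ultimately show "C \<inter> cyl \<sigma> n \<noteq> {}" "D \<inter> cyl \<tau> n \<noteq> {}"
      using ns[of n] by (metis image_empty)+
  qed
  have "\<sigma> \<in> C"
  proof (rule ccontr)
    assume "\<sigma> \<notin> C"
    then obtain n where "cyl \<sigma> n \<subseteq> - C"
      using open_cyl[OF C[unfolded closed_def]] by blast
    then show False using ne(1)[of n] by blast
  qed
  have "\<tau> \<in> D"
  proof (rule ccontr)
    assume "\<tau> \<notin> D"
    then obtain n where "cyl \<tau> n \<subseteq> - D"
      using open_cyl[OF D[unfolded closed_def]] by blast
    then show False using ne(2)[of n] by blast
  qed
  have "f \<sigma> \<noteq> g \<tau>" using A B \<open>\<sigma> \<in> C\<close> \<open>\<tau> \<in> D\<close> assms(4) by blast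
  moreover have "f \<sigma> \<in> topspace X" "g \<tau> \<in> topspace X" using sub \<open>\<sigma> \<in> C\<close> \<open>\<tau> \<in> D\<close> by auto
  ultimately obtain U V where UV: "openin X U" "openin X V" "f \<sigma> \<in> U" "g \<tau> \<in> V" "U \<inter> V = {}"
    using X unfolding Hausdorff_space_def disjnt_def by metis
  \<comment> \<open>Stated for all \<open>m \<ge> n\<close>, so that one level serves both
    maps.\<close>
  have near: "\<exists>n. \<forall>m\<ge>n. e ` (E \<inter> cyl \<rho> m) \<subseteq> W"
    if e: "continuous_map (top_of_set E) X e" "openin X W" "\<rho> \<in> E" "e \<rho> \<in> W" for E e W \<rho>
  proof -
    obtain T where T: "open T" "{\<sigma> \<in> E. e \<sigma> \<in> W} = E \<inter> T"
      using openin_continuous_map_preimage[OF e(1,2)] by (auto simp: openin_open)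
    then have "\<rho> \<in> T" using e(3,4) by blast
    then obtain n where n: "cyl \<rho> n \<subseteq> T"
      using open_cyl[OF T(1)] by blast
    have "cyl \<rho> m \<subseteq> cyl \<rho> n" if "m \<ge> n" for m using that by (auto simp: cyl_def)
    then show ?thesis using n T(2) by blast
  qed
  obtain n where n: "\<forall>m\<ge>n. f ` (C \<inter> cyl \<sigma> m) \<subseteq> U"
    using near[OF f UV(1) \<open>\<sigma> \<in> C\<close> UV(3)] by blast
  obtain n' where n': "\<forall>m\<ge>n'. g ` (D \<inter> cyl \<tau> m) \<subseteq> V"
    using near[OF g UV(2) \<open>\<tau> \<in> D\<close> UV(4)] by blast
  have "f ` (C \<inter> cyl \<sigma> (max n n')) \<subseteq> U" "U \<inter> g ` (D \<inter> cyl \<tau> (max n n')) = {}"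
    using n n' UV(5) by (auto dest!: spec[of _ "max n n'"])
  moreover have "U \<in> ?S" using UV(1) by blast
  ultimately show False using ns[of "max n n'"] unfolding separated_by_def by blast
qed

section \<open>Chains, and peeling off Borel antichains\<close>

text \<open>The index counts strict steps, so in a partial order these are the tops of chains with
  \<open>n + 1\<close> elements. Each recursive step is a projection, which preserves
  analyticity.\<close>

fun chain_tops :: "'a rel \<Rightarrow> 'a set \<Rightarrow> nat \<Rightarrow> 'a set" where
  "chain_tops r D 0 = D"
| "chain_tops r D (Suc n) = {x \<in> D. \<exists>y\<in>chain_tops r D n. (y, x) \<in> r - Id}"

lemma chain_tops_subset: "chain_tops r D n \<subseteq> D"
  by (cases n) auto

lemma chain_tops_mono: "D \<subseteq> E \<Longrightarrow> chain_tops r D n \<subseteq> chain_tops r E n"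
  by (induction n) auto

text \<open>That \<open>x\<close> is the top of \<open>C\<close> is carried along for the induction:
  transitivity keeps the chain below the new top, and antisymmetry makes the new top a new
  element.\<close>

lemma chain_tops_imp_chain:
  assumes r: "partial_order_on V r" and x: "x \<in> chain_tops r V n"
  shows "\<exists>C\<in>Chains r. finite C \<and> card C = Suc n \<and> (\<forall>y\<in>C. (y, x) \<in> r)"
  using x
proof (induction n arbitrary: x)
  case 0
  have "(x, x) \<in> r" using r 0 by (auto simp: partial_order_on_def preorder_on_def refl_on_def)
  then show ?case by (intro bexI[of _ "{x}"]) (auto simp: Chains_def)
next
  case (Suc n)
  then obtain y where y: "y \<in> chain_tops r V n" "(y, x) \<in> r" "y \<noteq> x" and "x \<in> V" by auto
  have xx: "(x, x) \<in> r"
    using r \<open>x \<in> V\<close> by (auto simp: partial_order_on_def preorder_on_def refl_on_def)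
  have tr: "trans r" and as: "antisym r"
    using r by (auto simp: partial_order_on_def preorder_on_def)
  obtain C where C: "C \<in> Chains r" "finite C" "card C = Suc n" "\<forall>z\<in>C. (z, y) \<in> r"
    using Suc.IH[OF y(1)] by blast
  have below: "(z, x) \<in> r" if "z \<in> C" for z using C(4) y(2) tr that by (meson transD)
  moreover have "x \<notin> C" using C(4) y as by (meson antisymD)
  moreover have "insert x C \<in> Chains r" using C(1) below xx by (auto simp: Chains_def)
  ultimately show ?case
    using C xx by (intro bexI[of _ "insert x C"]) auto
qed

text \<open>The induction varies \<open>D\<close>, since it continues with \<open>D - S\<close>.
  Some \<open>F i\<close> may be empty here.\<close>

lemma Borel_antichain_cover:
  fixes M :: "'a measure"
  assumes X: "Polish_topology X"
    and sets: "sets M = sigma_sets (topspace X) {U. openin X U}"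
    and r: "analytic_in (prod_topology X X) (r - Id)"
    and D: "D \<in> sets M" and "chain_tops r D k = {}"
  shows "\<exists>F. (\<Union>i<k. F i) = D \<and> disjoint_family_on F {..<k} \<and>
           (\<forall>i<k. F i \<in> sets M \<and> antichain_in (space M) r (F i))"
  using D \<open>chain_tops r D k = {}\<close>
proof (induction k arbitrary: D)
  case 0
  then show ?case by (auto simp: disjoint_family_on_def)
next
  case (Suc k)
  let ?R = "r - Id" and ?XX = "prod_topology X X"
  have H: "Hausdorff_space X" using X by (rule Polish_imp_Hausdorff)
  have aD: "analytic_in X D" using analytic_in_Borel[OF X] Suc.prems(1) sets by simp
  \<comment> \<open>The strictly related pairs from \<open>S\<close> to \<open>T\<close>; projecting
    them gives both sets to be separated.\<close>
  have D2: "analytic_in ?XX {p \<in> {p \<in> ?R. fst p \<in> S}. snd p \<in> T}"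
    if "analytic_in X S" "analytic_in X T" for S T
    by (intro analytic_in_Int_vimage[of _ _ X] r that H continuous_map_fst continuous_map_snd)
  have tops: "analytic_in X (chain_tops r D n)" for n
  proof (induction n)
    case (Suc n)
    have "snd ` {p \<in> {p \<in> ?R. fst p \<in> chain_tops r D n}. snd p \<in> D} = chain_tops r D (Suc n)"
      by force
    then show ?case
      using analytic_in_image[OF D2[OF Suc aD] continuous_map_snd] by metis
  qed (simp add: aD)
  define B where "B = {x \<in> D. \<exists>y\<in>D. (x, y) \<in> ?R}"
  have "fst ` {p \<in> {p \<in> ?R. fst p \<in> D}. snd p \<in> D} = B" by (force simp: B_def)
  then have "analytic_in X B"
    using analytic_in_image[OF D2[OF aD aD] continuous_map_fst] by metis
  \<comment> \<open>A common element would lie strictly below some element of \<open>D\<close>,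
    which would then belong to \<open>chain_tops r D (Suc k)\<close>.\<close>
  moreover have "chain_tops r D k \<inter> B = {}"
    using Suc.prems(2) by (auto simp: B_def)
  ultimately have "separated_by (sets M) (chain_tops r D k) B"
    unfolding sets by (intro Lusin_separation H tops)
  then obtain S where S: "S \<in> sets M" "chain_tops r D k \<subseteq> S" "S \<inter> B = {}"
    unfolding separated_by_def by blast
  \<comment> \<open>Such tops lie outside \<open>S\<close>, yet by monotonicity they are tops in
    \<open>D\<close>, all of which \<open>S\<close> contains.\<close>
  have "chain_tops r (D - S) k = {}"
    using chain_tops_subset[of r "D - S" k] chain_tops_mono[of "D - S" D r k] S(2) by blast
  then obtain F where F: "(\<Union>i<k. F i) = D - S" "disjoint_family_on F {..<k}"
    "\<And>i. i < k \<Longrightarrow> F i \<in> sets M \<and> antichain_in (space M) r (F i)"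
    using Suc.IH[of "D - S"] Suc.prems(1) S(1) by (meson sets.Diff)
  \<comment> \<open>Of two distinct related elements of \<open>D\<close>, the smaller is in
    \<open>B\<close>, which \<open>S\<close> avoids.\<close>
  have DS: "antichain_in (space M) r (D \<inter> S)"
    using S(3) sets.sets_into_space[OF Suc.prems(1)] by (auto simp: antichain_in_def B_def)
  define G where "G = F(k := D \<inter> S)"
  have "(\<Union>i<Suc k. G i) = (\<Union>i<k. F i) \<union> (D \<inter> S)"
    by (auto simp: G_def lessThan_Suc)
  then have "(\<Union>i<Suc k. G i) = D" using F(1) by auto
  moreover have "disjoint_family_on G {..<Suc k}"
    using F(1,2) unfolding disjoint_family_on_def G_def by (fastforce simp: less_Suc_eq)
  moreover have "\<forall>i<Suc k. G i \<in> sets M \<and> antichain_in (space M) r (G i)"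
    using F(3) DS Suc.prems(1) S(1) by (auto simp: G_def less_Suc_eq)
  ultimately show ?case by blast
qed

section \<open>Borel sets of the product, and the final partition\<close>

text \<open>Both projections are measurable for the Borel sets of the product topology, hence so is
  the identity map into \<open>M \<Otimes>\<^sub>M N\<close>. Pulling back along it gives the
  inclusion.\<close>

lemma sets_pair_subset_Borel_prod:
  fixes M :: "'a measure" and N :: "'b measure"
  assumes X: "topspace X = space M" "sets M = sigma_sets (topspace X) {U. openin X U}"
    and Y: "topspace Y = space N" "sets N = sigma_sets (topspace Y) {U. openin Y U}"
  shows "sets (M \<Otimes>\<^sub>M N) \<subseteq>
    sigma_sets (topspace (prod_topology X Y)) {U. openin (prod_topology X Y) U}"
proof -
  let ?Z = "prod_topology X Y"
  define B where "B = sigma (topspace ?Z) {U. openin ?Z U}"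
  have B: "space B = space M \<times> space N" "sets B = sigma_sets (topspace ?Z) {U. openin ?Z U}"
    using openin_subset[of ?Z] X(1) Y(1) unfolding B_def
    by (auto simp: space_measure_of_conv subset_iff)
  have 1: "fst \<in> measurable B M"
  proof (rule measurable_sigma_sets[OF X(2)])
    fix U assume "U \<in> {U. openin X U}"
    then have "openin ?Z {p \<in> topspace ?Z. fst p \<in> U}"
      using openin_continuous_map_preimage[OF continuous_map_fst] by blast
    moreover have "fst -` U \<inter> space B = {p \<in> topspace ?Z. fst p \<in> U}"
      using B X Y by auto
    ultimately show "fst -` U \<inter> space B \<in> sets B" using B by auto
  next
    show "{U. openin X U} \<subseteq> Pow (topspace X)" using openin_subset by blast
    show "fst \<in> space B \<rightarrow> topspace X" using B(1) X(1) by auto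
  qed
  have 2: "snd \<in> measurable B N"
  proof (rule measurable_sigma_sets[OF Y(2)])
    fix U assume "U \<in> {U. openin Y U}"
    then have "openin ?Z {p \<in> topspace ?Z. snd p \<in> U}"
      using openin_continuous_map_preimage[OF continuous_map_snd] by blast
    moreover have "snd -` U \<inter> space B = {p \<in> topspace ?Z. snd p \<in> U}"
      using B X Y by auto
    ultimately show "snd -` U \<inter> space B \<in> sets B" using B by auto
  next
    show "{U. openin Y U} \<subseteq> Pow (topspace Y)" using openin_subset by blast
    show "snd \<in> space B \<rightarrow> topspace Y" using B(1) Y(1) by auto
  qed
  have "(\<lambda>p. (fst p, snd p)) \<in> measurable B (M \<Otimes>\<^sub>M N)"
    using 1 2 by (rule measurable_Pair)
  then have id: "(\<lambda>p. p) \<in> measurable B (M \<Otimes>\<^sub>M N)" by simp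
  show ?thesis
  proof
    fix E assume E: "E \<in> sets (M \<Otimes>\<^sub>M N)"
    then have "E \<subseteq> space B" using sets.sets_into_space[OF E] B by (simp add: space_pair_measure)
    then show "E \<in> sigma_sets (topspace ?Z) {U. openin ?Z U}"
      using measurable_sets[OF id E] B by (simp add: Int_absorb2)
  qed
qed

theorem theorem5:
  fixes M :: "'a measure" and r :: "'a rel" and h :: nat
  assumes "Borel_poset M r"
    and "has_finite_height r h"
    and "locally_countable_graph (space M) (comparability_graph r)"
  shows "\<exists>\<A>. partition_on (space M) \<A> \<and> finite \<A> \<and> card \<A> = h \<and>
           (\<forall>A\<in>\<A>. antichain_in (space M) r A \<and> A \<in> sets M)"
proof -
  have po: "partial_order_on (space M) r" and rM: "r \<in> sets (M \<Otimes>\<^sub>M M)"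
    using assms(1) by (auto simp: Borel_poset_def)
  obtain X where X: "Polish_topology X" and sp: "topspace X = space M"
    and sets: "sets M = sigma_sets (topspace X) {U. openin X U}"
    using assms(1) by (auto simp: Borel_poset_def standard_Borel_space_def)
  let ?Z = "prod_topology X X"
  have Z: "Polish_topology ?Z" using X X by (rule Polish_topology_prod)
  interpret Z: sigma_algebra "topspace ?Z" "sigma_sets (topspace ?Z) {U. openin ?Z U}"
    by (rule sigma_algebra_openin)
  \<comment> \<open>The diagonal of a Hausdorff space is closed, so removing it from
    \<open>r\<close> leaves a Borel, hence analytic, strict order.\<close>
  let ?\<Delta> = "(\<lambda>x. (x, x)) ` topspace X"
  have "closedin ?Z ?\<Delta>"
    using Polish_imp_Hausdorff[OF X] by (simp add: Hausdorff_space_closedin_diagonal)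
  then have "topspace ?Z - ?\<Delta> \<in> sigma_sets (topspace ?Z) {U. openin ?Z U}" by blast
  then have "r \<inter> (topspace ?Z - ?\<Delta>) \<in> sigma_sets (topspace ?Z) {U. openin ?Z U}"
    using sets_pair_subset_Borel_prod[OF sp sets sp sets] rM by blast
  moreover have "r \<inter> (topspace ?Z - ?\<Delta>) = r - Id"
    using sets.sets_into_space[OF rM] sp by (auto simp: space_pair_measure)
  ultimately have R: "analytic_in ?Z (r - Id)"
    using analytic_in_Borel[OF Z] by metis
  have "chain_tops r (space M) h = {}"
  proof (rule ccontr)
    assume "chain_tops r (space M) h \<noteq> {}"
    then obtain x where "x \<in> chain_tops r (space M) h" by blast
    from chain_tops_imp_chain[OF po this] obtain C where "C \<in> Chains r" "card C = Suc h" by blast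
    then show False using assms(2) by (auto simp: has_finite_height_def)
  qed
  from Borel_antichain_cover[OF X sets R sets.top this]
  obtain F where F: "(\<Union>i<h. F i) = space M" "disjoint_family_on F {..<h}"
    "\<And>i. i < h \<Longrightarrow> F i \<in> sets M \<and> antichain_in (space M) r (F i)" by blast
  obtain C where C: "C \<in> Chains r" "finite C" "card C = h"
    using assms(2) by (auto simp: has_finite_height_def)
  have Csub: "C \<subseteq> space M"
    using C(1) po by (auto simp: Chains_def partial_order_on_def preorder_on_def refl_on_def)
  have "\<forall>x\<in>C. \<exists>i. i < h \<and> x \<in> F i" using Csub F(1) by blast
  then obtain c where c: "\<And>x. x \<in> C \<Longrightarrow> c x < h \<and> x \<in> F (c x)" by metis
  \<comment> \<open>Elements of \<open>C\<close> with the same index would be comparable members of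
    one antichain. As \<open>C\<close> has \<open>h\<close> elements, every index is then
    hit.\<close>
  have "inj_on c C"
  proof (rule inj_onI)
    fix x y assume xy: "x \<in> C" "y \<in> C" "c x = c y"
    have "(x, y) \<in> r \<or> (y, x) \<in> r" using C(1) xy by (auto simp: Chains_def)
    then show "x = y" using c[OF xy(1)] c[OF xy(2)] xy(3) F(3) by (metis antichain_in_def)
  qed
  then have "c ` C = {..<h}"
    using c C by (intro card_subset_eq) (auto simp: card_image)
  have ne: "F i \<noteq> {}" if "i < h" for i
  proof -
    have "i \<in> c ` C" using that \<open>c ` C = {..<h}\<close> by simp
    then obtain x where "x \<in> C" "i = c x" by (rule imageE)
    then show ?thesis using c[of x] by auto
  qed
  have dj: "F i \<inter> F j = {}" if "i < h" "j < h" "i \<noteq> j" for i j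
    using F(2) that by (auto simp: disjoint_family_on_def)
  \<comment> \<open>Nonempty disjoint classes are distinct, so the family has exactly
    \<open>h\<close> members.\<close>
  have "inj_on F {..<h}"
    using dj ne by (intro inj_onI) (metis inf.idem lessThan_iff)
  then have "card (F ` {..<h}) = h" by (simp add: card_image)
  moreover have "partition_on (space M) (F ` {..<h})"
  proof (rule partition_onI)
    show "\<Union> (F ` {..<h}) = space M" by (rule F(1))
    show "{} \<notin> F ` {..<h}" using ne by auto
    show "disjnt A B" if AB: "A \<in> F ` {..<h}" "B \<in> F ` {..<h}" "A \<noteq> B" for A B
      using AB dj unfolding disjnt_def by (metis imageE lessThan_iff)
  qed
  ultimately show ?thesis using F(3) by (intro exI[of _ "F ` {..<h}"]) auto
qed

end
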